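(* There is no cofibration category structure on the category $\mathcal{G}$ of finite graphs with the $\times$-homotopy equivalences as weak equivalences. That is, there is no class of morphisms of $\mathcal{G}$ (called cofibrations) which, together with the class $\mathcal{W}_\times$ of all $\times$-homotopy equivalences as the class of weak equivalences, makes $\mathcal{G}$ a cofibration category.
   Context: Graphs: $\mathcal{G}$ is the category of finite undirected graphs without multiple edges (loops are allowed; the empty graph is allowed). A morphism (graph map) is a function on vertices that sends edges to edges. Product: $G\times H$ has vertex set $V(G)\times V(H)$, and $(g,h)(g',h')$ is an edge iff $gg'\in E(G)$ and $hh'\in E(H)$. For $n\in\mathbb{N}$, $I_n$ is the graph with vertex set $\{0,1,\dots,n\}$ and edge set $\{ij : |i-j|\le 1\}$ (so every vertex is looped). $\times$-homotopy: graph maps $f,g:A\to B$ are $\times$-homotopic, $f\simeq_\times g$, if for some $n\in\mathbb{N}$ there is a graph map $F:A\times I_n\to B$ with $F|_{A\times\{0\}}=f$ and $F|_{A\times\{n\}}=g$. A graph map $f:A\to B$ is a $\times$-homotopy equivalence if there is a graph map $g:B\to A$ with $gf\simeq_\times 1_A$ and $fg\simeq_\times 1_B$. Cofibration category: a category with two distinguished subclasses of morphisms, weak equivalences and cofibrations, satisfying: (1) weak equivalences satisfy the 2 out of 6 property: for composable morphisms $f:A\to B$, $g:B\to C$, $h:C\to D$, if $gf$ and $hg$ are weak equivalences, then so are $f,g,h$ and $hgf$; (2) every isomorphism is an acyclic cofibration, i.e. both a weak equivalence and a cofibration; (3) an initial object exists; (4) every object $X$ is cofibrant, i.e. the map from the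 initial object to $X$ is a cofibration; (5) cofibrations and acyclic cofibrations are preserved under cobase change (pushout along arbitrary morphisms); (6) every morphism factors as a cofibration followed by a weak equivalence.
   Formalization: The class of cofibrations is additionally required to be closed under composition, as in the usual definition (cofibrations form a subcategory); for arbitrary classes satisfying only (1)–(6) the non-existence claim fails. *)

theory Defs
  imports
    "HOL-Library.FuncSet"
    "HOL-Library.Infinite_Typeclass"
    "Graph_Theory.Pair_Digraph"
begin

section \<open>Categories\<close>

text \<open>\<open>Cmp C g f\<close> is the composite written \<open>g f\<close>, that is, \<open>f\<close> first.\<close>

record ('o, 'm) cat_data =
  Obj :: "'o set"
  Mor :: "'m set"
  Dom :: "'m \<Rightarrow> 'o"
  Cod :: "'m \<Rightarrow> 'o"
  Idn :: "'o \<Rightarrow> 'm"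
  Cmp :: "'m \<Rightarrow> 'm \<Rightarrow> 'm"

definition Hom :: "('o, 'm) cat_data \<Rightarrow> 'o \<Rightarrow> 'o \<Rightarrow> 'm set" where
  "Hom C A B = {f \<in> Mor C. Dom C f = A \<and> Cod C f = B}"

locale category =
  fixes C :: "('o, 'm) cat_data"
  assumes Dom_in_Obj: "f \<in> Mor C \<Longrightarrow> Dom C f \<in> Obj C"
    and Cod_in_Obj: "f \<in> Mor C \<Longrightarrow> Cod C f \<in> Obj C"
    and Idn_in_Hom: "A \<in> Obj C \<Longrightarrow> Idn C A \<in> Hom C A A"
    and Cmp_in_Hom: "f \<in> Hom C A B \<Longrightarrow> g \<in> Hom C B D \<Longrightarrow> Cmp C g f \<in> Hom C A D"
    and Cmp_Idn_right: "f \<in> Hom C A B \<Longrightarrow> Cmp C f (Idn C A) = f"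
    and Cmp_Idn_left: "f \<in> Hom C A B \<Longrightarrow> Cmp C (Idn C B) f = f"
    and Cmp_assoc: "f \<in> Hom C A B \<Longrightarrow> g \<in> Hom C B D \<Longrightarrow> h \<in> Hom C D E \<Longrightarrow>
      Cmp C h (Cmp C g f) = Cmp C (Cmp C h g) f"

definition isomorphism :: "('o, 'm) cat_data \<Rightarrow> 'm \<Rightarrow> bool" where
  "isomorphism C f \<longleftrightarrow> f \<in> Mor C \<and>
     (\<exists>g \<in> Hom C (Cod C f) (Dom C f).
        Cmp C g f = Idn C (Dom C f) \<and> Cmp C f g = Idn C (Cod C f))"

definition initial_object :: "('o, 'm) cat_data \<Rightarrow> 'o \<Rightarrow> bool" where
  "initial_object C I \<longleftrightarrow> I \<in> Obj C \<and> (\<forall>X \<in> Obj C. \<exists>!f. f \<in> Hom C I X)"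

text \<open>
  In \<open>pushout_square C f g f' g'\<close> the morphism \<open>f'\<close> is the cobase change of \<open>f\<close> along \<open>g\<close>,
  and \<open>g'\<close> that of \<open>g\<close> along \<open>f\<close>.
\<close>

definition pushout_square :: "('o, 'm) cat_data \<Rightarrow> 'm \<Rightarrow> 'm \<Rightarrow> 'm \<Rightarrow> 'm \<Rightarrow> bool" where
  "pushout_square C f g f' g' \<longleftrightarrow>
     (\<exists>A B X P. f \<in> Hom C A B \<and> g \<in> Hom C A X \<and> f' \<in> Hom C X P \<and> g' \<in> Hom C B P \<and>
        Cmp C f' g = Cmp C g' f \<and>
        (\<forall>Q. \<forall>u \<in> Hom C X Q. \<forall>v \<in> Hom C B Q. Cmp C u g = Cmp C v f \<longrightarrow>
           (\<exists>!w. w \<in> Hom C P Q \<and> Cmp C w f' = u \<and> Cmp C w g' = v)))"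

section \<open>Cofibration categories\<close>

text \<open>
  The cofibrations and the weak equivalences are the morphisms of two subcategories. For the
  weak equivalences, closure under composition follows from 2 out of 6 together with the
  presence of identities (apply it to \<open>f\<close>, an identity, \<open>g\<close>), and identities are acyclic
  cofibrations because they are isomorphisms; so closure of the cofibrations under composition
  is all that has to be said. The cobase change axioms concern all pushout squares that
  exist in \<open>C\<close> and do not themselves demand the existence of pushouts.
\<close>

locale cofibration_category = category C for C :: "('o, 'm) cat_data" +
  fixes weq :: "'m set" and cof :: "'m set"
  assumes weq_subset: "weq \<subseteq> Mor C"
    and cof_subset: "cof \<subseteq> Mor C"
    and cof_Cmp: "f \<in> cof \<Longrightarrow> g \<in> cof \<Longrightarrow> Cod C f = Dom C g \<Longrightarrow> Cmp C g f \<in> cof"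
    and two_out_of_six:
      "f \<in> Hom C A B \<Longrightarrow> g \<in> Hom C B D \<Longrightarrow> h \<in> Hom C D E \<Longrightarrow>
       Cmp C g f \<in> weq \<Longrightarrow> Cmp C h g \<in> weq \<Longrightarrow>
       f \<in> weq \<and> g \<in> weq \<and> h \<in> weq \<and> Cmp C h (Cmp C g f) \<in> weq"
    and iso_acyclic_cof: "isomorphism C f \<Longrightarrow> f \<in> weq \<inter> cof"
    and initial_exists: "\<exists>I. initial_object C I"
    and all_cofibrant: "initial_object C I \<Longrightarrow> X \<in> Obj C \<Longrightarrow> i \<in> Hom C I X \<Longrightarrow> i \<in> cof"
    and cof_cobase_change: "pushout_square C f g f' g' \<Longrightarrow> f \<in> cof \<Longrightarrow> f' \<in> cof"
    and acyclic_cof_cobase_change: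
      "pushout_square C f g f' g' \<Longrightarrow> f \<in> weq \<inter> cof \<Longrightarrow> f' \<in> weq \<inter> cof"
    and factorization: "f \<in> Mor C \<Longrightarrow>
      \<exists>i p. i \<in> cof \<and> p \<in> weq \<and> Cod C i = Dom C p \<and> Cmp C p i = f"

section \<open>Finite graphs and graph maps\<close>

text \<open>
  A finite undirected graph without multiple edges, loops allowed, is a
  \<^locale>\<open>pair_pseudo_graph\<close>: a finite vertex set with a symmetric set of arcs, an edge
  \<open>uv\<close> being given by the arcs \<open>(u, v)\<close> and \<open>(v, u)\<close>. Over an infinite vertex type every
  finite graph occurs up to isomorphism. Graph maps are extensional, so that equality of
  morphisms is equality of maps on the vertex set.
\<close>

definition graph_maps :: "'a pair_pre_digraph \<Rightarrow> 'b pair_pre_digraph \<Rightarrow> ('a \<Rightarrow> 'b) set" where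
  "graph_maps G H = {f \<in> pverts G \<rightarrow>\<^sub>E pverts H. \<forall>u v. (u, v) \<in> parcs G \<longrightarrow> (f u, f v) \<in> parcs H}"

datatype 'v gmorph =
  GMorph (src: "'v pair_pre_digraph") (app: "'v \<Rightarrow> 'v") (tgt: "'v pair_pre_digraph")

definition graph_category :: "('v pair_pre_digraph, 'v gmorph) cat_data" where
  "graph_category =
     \<lparr> Obj = {G. pair_pseudo_graph G},
       Mor = {m. pair_pseudo_graph (src m) \<and> pair_pseudo_graph (tgt m) \<and>
                 app m \<in> graph_maps (src m) (tgt m)},
       Dom = src,
       Cod = tgt,
       Idn = (\<lambda>G. GMorph G (restrict id (pverts G)) G),
       Cmp = (\<lambda>g f. GMorph (src f) (compose (pverts (src f)) (app g) (app f)) (tgt g)) \<rparr>"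

lemma pair_pseudo_graph_arc_verts:
  assumes "pair_pseudo_graph G" "(u, v) \<in> parcs G"
  shows "u \<in> pverts G" "v \<in> pverts G"
proof -
  interpret pair_pseudo_graph G by fact
  show "u \<in> pverts G" "v \<in> pverts G" using assms(2) by (auto dest: in_arcsD1 in_arcsD2)
qed

lemma graph_category_is_category: "category graph_category"
proof
  fix f g h :: "'v gmorph" and A B D E :: "'v pair_pre_digraph"
  assume "f \<in> Hom graph_category A B" "g \<in> Hom graph_category B D" "h \<in> Hom graph_category D E"
  then show "Cmp graph_category h (Cmp graph_category g f)
    = Cmp graph_category (Cmp graph_category h g) f"
    by (auto simp: graph_category_def Hom_def graph_maps_def compose_def fun_eq_iff)
next
  fix f :: "'v gmorph" and A B :: "'v pair_pre_digraph"
  assume f: "f \<in> Hom graph_category A B"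
  then show "Cmp graph_category f (Idn graph_category A) = f"
    by (cases f) (auto simp: graph_category_def Hom_def graph_maps_def compose_def fun_eq_iff
        PiE_def extensional_def)
  from f show "Cmp graph_category (Idn graph_category B) f = f"
    by (cases f) (auto simp: graph_category_def Hom_def graph_maps_def compose_def fun_eq_iff
        PiE_def extensional_def)
next
  fix f g :: "'v gmorph" and A B D :: "'v pair_pre_digraph"
  assume "f \<in> Hom graph_category A B" "g \<in> Hom graph_category B D"
  then show "Cmp graph_category g f \<in> Hom graph_category A D"
    by (auto simp: graph_category_def Hom_def graph_maps_def compose_def
        PiE_iff
        dest: pair_pseudo_graph_arc_verts)
next
  fix A :: "'v pair_pre_digraph"
  assume "A \<in> Obj graph_category"
  then show "Idn graph_category A \<in> Hom graph_category A A"
    by (auto simp: graph_category_def Hom_def graph_maps_def dest: pair_pseudo_graph_arc_verts)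
qed (auto simp: graph_category_def)

section \<open>The \<open>\<times>\<close>-homotopy equivalences\<close>

definition graph_product ::
  "'a pair_pre_digraph \<Rightarrow> 'b pair_pre_digraph \<Rightarrow> ('a \<times> 'b) pair_pre_digraph" where
  "graph_product G H =
     \<lparr> pverts = pverts G \<times> pverts H,
       parcs = {((g, h), (g', h')) | g h g' h'. (g, g') \<in> parcs G \<and> (h, h') \<in> parcs H} \<rparr>"

definition interval_graph :: "nat \<Rightarrow> nat pair_pre_digraph" where
  "interval_graph n =
     \<lparr> pverts = {0..n}, parcs = {(i, j). i \<le> n \<and> j \<le> n \<and> \<bar>int i - int j\<bar> \<le> 1} \<rparr>"

definition times_homotopic ::
  "'a pair_pre_digraph \<Rightarrow> 'b pair_pre_digraph \<Rightarrow> ('a \<Rightarrow> 'b) \<Rightarrow> ('a \<Rightarrow> 'b) \<Rightarrow> bool" where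
  "times_homotopic A B f g \<longleftrightarrow>
     (\<exists>n. \<exists>F \<in> graph_maps (graph_product A (interval_graph n)) B.
        \<forall>a \<in> pverts A. F (a, 0) = f a \<and> F (a, n) = g a)"

definition times_homotopy_equivalences :: "'v gmorph set" where
  "times_homotopy_equivalences =
     {f \<in> Mor graph_category.
        \<exists>g \<in> Hom graph_category (tgt f) (src f).
          times_homotopic (src f) (src f)
            (app (Cmp graph_category g f)) (app (Idn graph_category (src f))) \<and>
          times_homotopic (tgt f) (tgt f)
            (app (Cmp graph_category f g)) (app (Idn graph_category (tgt f)))}"

end

theory Submission
  imports Defs
begin

text \<open>
  Let \<open>K\<close> be an edge and factor the fold map \<open>K + K \<rightarrow> K\<close> as a cofibration \<open>i\<close> into some \<open>X\<close>
  followed by a weak equivalence. Every path \<open>D\<close> with an edge is equivalent to \<open>K\<close>; map \<open>K + K\<close> to the two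
  end edges of \<open>D\<close>. The axioms make \<open>D\<close> include into some \<open>Z\<close> by an acyclic cofibration, where
  \<open>Z\<close> receives \<open>X\<close> under \<open>K + K\<close>. Choose \<open>D\<close> so that its end edges become identified, with a twist,
  when \<open>D\<close> is wrapped around an odd cycle \<open>M\<close>. The cobase change \<open>M \<rightarrow> W\<close> of \<open>D \<rightarrow> Z\<close> is a weak
  equivalence, so there is a map \<open>X \<rightarrow> Z \<rightarrow> W \<rightarrow> M\<close>, and it identifies the two ends of \<open>X\<close> with a
  twist. If \<open>M\<close> is longer than the number of vertices of \<open>X\<close>, this map misses a vertex of \<open>M\<close>, so it
  yields a 2-colouring of \<open>X\<close> that gives corresponding vertices of the two ends opposite colours.
  But \<open>X\<close> is equivalent to \<open>K\<close> by a map matching up the ends, and \<open>\<times>\<close>-homotopies preserve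
  2-colourings at non-isolated vertices.
\<close>

section \<open>Acyclic cofibrations under a common domain\<close>

lemma Hom_objs_eq: "f \<in> Hom C A B \<Longrightarrow> f \<in> Hom C A' B' \<Longrightarrow> A = A' \<and> B = B'"
  by (auto simp: Hom_def)

text \<open>The definition binds its objects existentially. A morphism has only one domain and one
  codomain, so they coincide with the \<open>A\<close>, \<open>B\<close> and \<open>X\<close> at
  hand.\<close>

lemma pushout_squareE:
  assumes "pushout_square C f g f' g'" "f \<in> Hom C A B" "g \<in> Hom C A X"
  obtains P where "f' \<in> Hom C X P" "g' \<in> Hom C B P" "Cmp C f' g = Cmp C g' f"
    "\<And>Q u v. u \<in> Hom C X Q \<Longrightarrow> v \<in> Hom C B Q \<Longrightarrow> Cmp C u g = Cmp C v f \<Longrightarrow>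
       \<exists>w. w \<in> Hom C P Q \<and> Cmp C w f' = u \<and> Cmp C w g' = v"
proof -
  obtain A1 B1 X1 P where *: "f \<in> Hom C A1 B1" "g \<in> Hom C A1 X1" "f' \<in> Hom C X1 P" "g' \<in> Hom C B1 P"
     "Cmp C f' g = Cmp C g' f"
     "\<forall>Q. \<forall>u \<in> Hom C X1 Q. \<forall>v \<in> Hom C B1 Q. Cmp C u g = Cmp C v f \<longrightarrow>
           (\<exists>!w. w \<in> Hom C P Q \<and> Cmp C w f' = u \<and> Cmp C w g' = v)"
    using assms(1) unfolding pushout_square_def by blast
  have "B1 = B" "X1 = X"
    using Hom_objs_eq[OF assms(2) *(1)] Hom_objs_eq[OF assms(3) *(2)] by simp_all
  with * show thesis by (intro that[of P]) blast+
qed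

context cofibration_category
begin

text \<open>2 out of 6 applies to \<open>f\<close>, \<open>g\<close> and the identity of
  \<open>D\<close>.\<close>

lemma weq_cancel_left:
  assumes "f \<in> Hom C A B" "g \<in> Hom C B D" "g \<in> weq" "Cmp C g f \<in> weq"
  shows "f \<in> weq"
proof -
  have "D \<in> Obj C" using assms(2) Cod_in_Obj by (auto simp: Hom_def)
  then have "Idn C D \<in> Hom C D D" by (rule Idn_in_Hom)
  with two_out_of_six[OF assms(1,2) this] assms show ?thesis
    by (simp add: Cmp_Idn_left[OF assms(2)])
qed

text \<open>The cofibration \<open>i\<close> yields an acyclic cofibration out of \<open>D\<close>:
  push \<open>i\<close> out along \<open>l\<close> and factor the induced map to \<open>K\<close>.
  The composite from \<open>D\<close> to \<open>Z\<close> is a cofibration, and it is a weak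
  equivalence because followed by one it gives \<open>q\<close>. Cobase change along
  \<open>d\<close> then carries it over to \<open>M\<close>. Since the axioms only speak of pushout
  squares that exist, existence enters as \<open>po\<close>.\<close>

lemma cofibration_into_weak_pushout:
  assumes po: "\<And>f g A B X. f \<in> Hom C A B \<Longrightarrow> g \<in> Hom C A X \<Longrightarrow> \<exists>f' g'. pushout_square C f g f' g'"
    and i: "i \<in> Hom C A X" "i \<in> cof"
    and p: "p \<in> Hom C X K"
    and l: "l \<in> Hom C A D"
    and q: "q \<in> Hom C D K" "q \<in> weq"
    and eq: "Cmp C p i = Cmp C q l"
    and d: "d \<in> Hom C D M"
  shows "\<exists>W. \<exists>a \<in> Hom C X W. \<exists>w \<in> Hom C M W. w \<in> weq \<and> Cmp C a i = Cmp C w (Cmp C d l)"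
proof -
  obtain i' l' where sq: "pushout_square C i l i' l'" using po[OF i(1) l] by blast
  then obtain P where P: "i' \<in> Hom C D P" "l' \<in> Hom C X P" "Cmp C i' l = Cmp C l' i"
    and ump: "\<And>Q u v. u \<in> Hom C D Q \<Longrightarrow> v \<in> Hom C X Q \<Longrightarrow> Cmp C u l = Cmp C v i \<Longrightarrow>
       \<exists>w. w \<in> Hom C P Q \<and> Cmp C w i' = u \<and> Cmp C w l' = v"
    using pushout_squareE[OF sq i(1) l] by metis
  have i'cof: "i' \<in> cof" using cof_cobase_change[OF sq i(2)] .
  obtain k where k: "k \<in> Hom C P K" "Cmp C k i' = q"
    using ump[OF q(1) p] eq by auto
  obtain z r where zr: "z \<in> cof" "r \<in> weq" "Cod C z = Dom C r" "Cmp C r z = k"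
    using factorization[of k] k(1) by (auto simp: Hom_def)
  define Z where "Z = Cod C z"
  have "z \<in> Mor C" "r \<in> Mor C" using zr cof_subset weq_subset by auto
  then have z0: "z \<in> Hom C (Dom C z) Z" and r0: "r \<in> Hom C Z (Cod C r)"
    using zr(3) by (auto simp: Hom_def Z_def)
  from Hom_objs_eq[OF Cmp_in_Hom[OF z0 r0, unfolded zr(4)] k(1)]
  have z: "z \<in> Hom C P Z" and r: "r \<in> Hom C Z K" using z0 r0 by auto
  define s where "s = Cmp C z i'"
  have s: "s \<in> Hom C D Z" unfolding s_def by (rule Cmp_in_Hom[OF P(1) z])
  have scof: "s \<in> cof" unfolding s_def
    using cof_Cmp[OF i'cof zr(1)] P(1) z by (auto simp: Hom_def)
  have "Cmp C r s = q" unfolding s_def using Cmp_assoc[OF P(1) z r] zr(4) k(2) by simp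
  then have sweq: "s \<in> weq" using weq_cancel_left[OF s r zr(2)] q(2) by simp
  obtain w e where sq2: "pushout_square C s d w e" using po[OF s d] by blast
  then obtain W where W: "w \<in> Hom C M W" "e \<in> Hom C Z W" "Cmp C w d = Cmp C e s"
    using pushout_squareE[OF sq2 s d] by metis
  have wweq: "w \<in> weq" using acyclic_cof_cobase_change[OF sq2] sweq scof by blast
  let ?a = "Cmp C e (Cmp C z l')"
  have zl: "Cmp C z l' \<in> Hom C X Z" by (rule Cmp_in_Hom[OF P(2) z])
  have "Cmp C ?a i = Cmp C e (Cmp C (Cmp C z l') i)" using Cmp_assoc[OF i(1) zl W(2)] by simp
  also have "Cmp C (Cmp C z l') i = Cmp C z (Cmp C i' l)" using Cmp_assoc[OF i(1) P(2) z] P(3) by simp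
  also have "\<dots> = Cmp C s l" unfolding s_def by (rule Cmp_assoc[OF l P(1) z])
  also have "Cmp C e \<dots> = Cmp C (Cmp C w d) l" using Cmp_assoc[OF l s W(2)] W(3) by simp
  also have "\<dots> = Cmp C w (Cmp C d l)" using Cmp_assoc[OF l d W(1)] by simp
  finally have "Cmp C ?a i = Cmp C w (Cmp C d l)" .
  moreover have "?a \<in> Hom C X W" by (rule Cmp_in_Hom[OF zl W(2)])
  ultimately show ?thesis using W(1) wweq by blast
qed

end

section \<open>Pushouts of graphs\<close>

lemma pair_pseudo_graph_iff:
  "pair_pseudo_graph G \<longleftrightarrow> finite (pverts G) \<and> parcs G \<subseteq> pverts G \<times> pverts G \<and> sym (parcs G)"
proof
  assume "pair_pseudo_graph G"
  then interpret pair_pseudo_graph G .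
  show "finite (pverts G) \<and> parcs G \<subseteq> pverts G \<times> pverts G \<and> sym (parcs G)"
    using arcs_symmetric by (auto dest: in_arcsD1 in_arcsD2 intro: symI)
next
  assume *: "finite (pverts G) \<and> parcs G \<subseteq> pverts G \<times> pverts G \<and> sym (parcs G)"
  then have "finite (parcs G)" by (meson finite_SigmaI finite_subset)
  with * show "pair_pseudo_graph G"
    by unfold_locales (auto simp: symmetric_def)
qed

lemma Hom_graph_category:
  "f \<in> Hom graph_category A B \<longleftrightarrow>
     pair_pseudo_graph A \<and> pair_pseudo_graph B \<and> src f = A \<and> tgt f = B \<and> app f \<in> graph_maps A B"
  by (auto simp: Hom_def graph_category_def)

lemma Cmp_graph_category:
  "Cmp graph_category g f = GMorph (src f) (compose (pverts (src f)) (app g) (app f)) (tgt g)"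
  by (simp add: graph_category_def)

lemma app_Cmp:
  "f \<in> Hom graph_category A B \<Longrightarrow> a \<in> pverts A \<Longrightarrow> app (Cmp graph_category g f) a = app g (app f a)"
  by (auto simp: Cmp_graph_category compose_def Hom_graph_category)

lemma gmorph_eqI:
  assumes "f \<in> Hom graph_category A B" "g \<in> Hom graph_category A B"
    and "\<And>a. a \<in> pverts A \<Longrightarrow> app f a = app g a"
  shows "f = g"
proof -
  have "app f = app g"
    using assms by (intro PiE_ext[of _ "pverts A" "\<lambda>_. pverts B"]) (auto simp: Hom_graph_category graph_maps_def)
  then show ?thesis using assms(1,2) by (cases f; cases g) (auto simp: Hom_graph_category)
qed

lemma Cmp_Hom_graph_category:
  "f \<in> Hom graph_category A B \<Longrightarrow> g \<in> Hom graph_category B D \<Longrightarrow> Cmp graph_category g f \<in> Hom graph_category A D"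
  by (rule category.Cmp_in_Hom[OF graph_category_is_category])

text \<open>This serves to name the classes of a finite quotient by elements of the vertex
  type.\<close>

lemma ex_inj_on_infinite:
  assumes "finite S"
  shows "\<exists>h :: 'a \<Rightarrow> 'v::infinite. inj_on h S"
proof -
  obtain B :: "'v set" where "finite B" "card B = card S"
    using infinite_arbitrarily_large[OF infinite_UNIV] by blast
  then show ?thesis using assms inj_on_iff_card_le[of S B] by auto
qed

text \<open>The pushout is the disjoint union of \<open>X\<close> and \<open>B\<close> with the two
  images of each vertex of \<open>A\<close> glued. Its arcs are exactly the images of arcs of
  \<open>X\<close> and \<open>B\<close>.\<close>

lemma graph_category_pushout:
  fixes f g :: "'v::infinite gmorph"
  assumes f: "f \<in> Hom graph_category A B" and g: "g \<in> Hom graph_category A X"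
  shows "\<exists>f' g'. pushout_square graph_category f g f' g'"
proof -
  define R :: "(('v + 'v) \<times> ('v + 'v)) set" where
    "R = {(Inl (app g a), Inr (app f a)) | a. a \<in> pverts A}"
  define E where "E = (R \<union> R\<inverse>)\<^sup>*"
  define S where "S = Inl ` pverts X \<union> Inr ` pverts B"
  have symE: "sym E" unfolding E_def by (intro sym_rtrancl symI) auto
  define cl where "cl = (\<lambda>x. E `` {x})"
  have cl_eq: "cl x = cl y \<longleftrightarrow> (x, y) \<in> E" for x y
    using symE unfolding cl_def E_def by (auto dest: symD intro: rtrancl_trans)
  have "finite S" using f g unfolding S_def by (auto simp: Hom_graph_category pair_pseudo_graph_iff)
  then obtain h :: "('v + 'v) set \<Rightarrow> 'v" where h: "inj_on h (cl ` S)"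
    using ex_inj_on_infinite[of "cl ` S"] by auto
  define c where "c = (\<lambda>x. h (cl x))"
  have c_eq: "c x = c y \<longleftrightarrow> (x, y) \<in> E" if "x \<in> S" "y \<in> S" for x y
    using that h cl_eq[of x y] by (auto simp: c_def inj_on_def)
  define P where "P = \<lparr>pverts = c ` S,
    parcs = {(c (Inl x), c (Inl y)) | x y. (x, y) \<in> parcs X} \<union>
            {(c (Inr x), c (Inr y)) | x y. (x, y) \<in> parcs B}\<rparr>"
  have P: "pair_pseudo_graph P"
    using f g \<open>finite S\<close> unfolding pair_pseudo_graph_iff P_def S_def Hom_graph_category sym_def
    by fastforce
  define f' where "f' = GMorph X (\<lambda>x\<in>pverts X. c (Inl x)) P"
  define g' where "g' = GMorph B (\<lambda>x\<in>pverts B. c (Inr x)) P"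
  have f': "f' \<in> Hom graph_category X P"
    using g P unfolding Hom_graph_category f'_def graph_maps_def
    by (auto simp: P_def S_def pair_pseudo_graph_arc_verts)
  have g': "g' \<in> Hom graph_category B P"
    using f P unfolding Hom_graph_category g'_def graph_maps_def
    by (auto simp: P_def S_def pair_pseudo_graph_arc_verts)
  have fA: "app f a \<in> pverts B" and gA: "app g a \<in> pverts X" if "a \<in> pverts A" for a
    using f g that by (auto simp: Hom_graph_category graph_maps_def)
  have comm: "Cmp graph_category f' g = Cmp graph_category g' f"
  proof (rule gmorph_eqI[OF Cmp_Hom_graph_category[OF g f'] Cmp_Hom_graph_category[OF f g']])
    fix a assume a: "a \<in> pverts A"
    have "(Inl (app g a), Inr (app f a)) \<in> E" unfolding E_def R_def using a by auto
    then have "c (Inl (app g a)) = c (Inr (app f a))" using c_eq fA[OF a] gA[OF a] by (auto simp: S_def)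
    then show "app (Cmp graph_category f' g) a = app (Cmp graph_category g' f) a"
      using a fA gA by (simp add: app_Cmp[OF f] app_Cmp[OF g] f'_def g'_def)
  qed
  have "\<exists>!w. w \<in> Hom graph_category P Q \<and> Cmp graph_category w f' = u \<and> Cmp graph_category w g' = v"
    if u: "u \<in> Hom graph_category X Q" and v: "v \<in> Hom graph_category B Q"
      and uv: "Cmp graph_category u g = Cmp graph_category v f" for Q u v
  proof (rule ex_ex1I)
    have ugvf: "app u (app g a) = app v (app f a)" if "a \<in> pverts A" for a
      using arg_cong[OF uv, of "\<lambda>m. app m a"] that by (simp add: app_Cmp[OF f] app_Cmp[OF g])
    define k where "k = case_sum (app u) (app v)"
    \<comment> \<open>\<open>k\<close> respects the generating relation, hence is constant on
      classes, and \<open>w\<close> may be evaluated at any representative.\<close>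
    have kE: "k x = k y" if "(x, y) \<in> E" for x y
      using that unfolding E_def
      by (induction rule: rtrancl_induct) (auto simp: R_def k_def ugvf)
    define w where "w = GMorph P (\<lambda>x\<in>c ` S. k (inv_into S c x)) Q"
    have wc: "app w (c x) = k x" if "x \<in> S" for x
    proof -
      have "inv_into S c (c x) \<in> S" "c (inv_into S c (c x)) = c x"
        using that by (auto intro: inv_into_into f_inv_into_f)
      then have "k (inv_into S c (c x)) = k x" using c_eq kE that by blast
      then show ?thesis using that by (simp add: w_def)
    qed
    have kS: "k x \<in> pverts Q" if "x \<in> S" for x
      using that u v by (auto simp: S_def k_def Hom_graph_category graph_maps_def)
    have "app w \<in> graph_maps P Q"
    proof -
      have "app w \<in> pverts P \<rightarrow>\<^sub>E pverts Q"
        using wc kS by (auto simp: P_def w_def PiE_def extensional_def)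
      moreover have "(app w x, app w y) \<in> parcs Q" if "(x, y) \<in> parcs P" for x y
      proof -
        from that consider
          (1) x' y' where "x = c (Inl x')" "y = c (Inl y')" "(x', y') \<in> parcs X"
          | (2) x' y' where "x = c (Inr x')" "y = c (Inr y')" "(x', y') \<in> parcs B"
          by (auto simp: P_def)
        then show ?thesis
        proof cases
          case 1
          then have "x' \<in> pverts X" "y' \<in> pverts X"
            using g by (auto simp: Hom_graph_category dest: pair_pseudo_graph_arc_verts)
          with 1 u show ?thesis
            by (auto simp: wc S_def k_def Hom_graph_category graph_maps_def)
        next
          case 2
          then have "x' \<in> pverts B" "y' \<in> pverts B"
            using f by (auto simp: Hom_graph_category dest: pair_pseudo_graph_arc_verts)
          with 2 v show ?thesis
            by (auto simp: wc S_def k_def Hom_graph_category graph_maps_def)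
        qed
      qed
      ultimately show ?thesis by (simp add: graph_maps_def)
    qed
    then have w: "w \<in> Hom graph_category P Q"
      using P u by (simp add: Hom_graph_category w_def)
    have "Cmp graph_category w f' = u"
      using wc by (intro gmorph_eqI[OF Cmp_Hom_graph_category[OF f' w] u])
        (simp add: app_Cmp[OF f'], simp add: f'_def S_def k_def)
    moreover have "Cmp graph_category w g' = v"
      using wc by (intro gmorph_eqI[OF Cmp_Hom_graph_category[OF g' w] v])
        (simp add: app_Cmp[OF g'], simp add: g'_def S_def k_def)
    ultimately show "\<exists>w. w \<in> Hom graph_category P Q \<and> Cmp graph_category w f' = u \<and>
        Cmp graph_category w g' = v" using w by blast
  next
    fix w1 w2
    assume w1: "w1 \<in> Hom graph_category P Q \<and> Cmp graph_category w1 f' = u \<and> Cmp graph_category w1 g' = v"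
      and w2: "w2 \<in> Hom graph_category P Q \<and> Cmp graph_category w2 f' = u \<and> Cmp graph_category w2 g' = v"
    show "w1 = w2"
    proof (rule gmorph_eqI)
      fix x assume "x \<in> pverts P"
      \<comment> \<open>Uniqueness holds because the images of \<open>f'\<close> and
        \<open>g'\<close> cover the vertices of \<open>P\<close>.\<close>
      then consider (1) y where "y \<in> pverts X" "x = app f' y" | (2) y where "y \<in> pverts B" "x = app g' y"
        by (auto simp: P_def S_def f'_def g'_def)
      then show "app w1 x = app w2 x"
        using w1 w2 app_Cmp[OF f'] app_Cmp[OF g'] by cases metis+
    qed (use w1 w2 in auto)
  qed
  with f g f' g' comm have "pushout_square graph_category f g f' g'"
    unfolding pushout_square_def by blast
  then show ?thesis by blast
qed

section \<open>Paths and odd cycles\<close>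

text \<open>
  All concrete graphs live on natural numbers and are transported to the vertex type along an
  injection \<open>e\<close>.
\<close>

definition copy_graph :: "(nat \<Rightarrow> 'v) \<Rightarrow> nat pair_pre_digraph \<Rightarrow> 'v pair_pre_digraph" where
  "copy_graph e G = \<lparr>pverts = e ` pverts G, parcs = {(e u, e v) | u v. (u, v) \<in> parcs G}\<rparr>"

definition copy_map ::
  "(nat \<Rightarrow> 'v) \<Rightarrow> nat pair_pre_digraph \<Rightarrow> nat pair_pre_digraph \<Rightarrow> (nat \<Rightarrow> nat) \<Rightarrow> 'v gmorph" where
  "copy_map e G H f =
     GMorph (copy_graph e G) (\<lambda>x\<in>e ` pverts G. e (f (inv e x))) (copy_graph e H)"

text \<open>Extensionality is left to \<open>copy_map\<close>, so that total functions such as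
  reduction modulo 2 can be used directly.\<close>

definition nat_graph_map :: "nat pair_pre_digraph \<Rightarrow> nat pair_pre_digraph \<Rightarrow> (nat \<Rightarrow> nat) \<Rightarrow> bool" where
  "nat_graph_map G H f \<longleftrightarrow>
     (\<forall>u \<in> pverts G. f u \<in> pverts H) \<and> (\<forall>u v. (u, v) \<in> parcs G \<longrightarrow> (f u, f v) \<in> parcs H)"

lemma copy_graph_pseudo:
  "pair_pseudo_graph G \<Longrightarrow> pair_pseudo_graph (copy_graph e G)"
  unfolding pair_pseudo_graph_iff copy_graph_def sym_def by fastforce

lemma copy_graph_arc_iff:
  "inj e \<Longrightarrow> (e u, e v) \<in> parcs (copy_graph e G) \<longleftrightarrow> (u, v) \<in> parcs G"
  by (auto simp: copy_graph_def dest: injD)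

lemma copy_map_Hom:
  assumes "inj e" "pair_pseudo_graph G" "pair_pseudo_graph H" "nat_graph_map G H f"
  shows "copy_map e G H f \<in> Hom graph_category (copy_graph e G) (copy_graph e H)"
proof -
  let ?f = "\<lambda>x\<in>e ` pverts G. e (f (inv e x))"
  have "?f \<in> pverts (copy_graph e G) \<rightarrow>\<^sub>E pverts (copy_graph e H)"
    using assms by (auto simp: copy_graph_def nat_graph_map_def)
  moreover have "(?f x, ?f y) \<in> parcs (copy_graph e H)" if "(x, y) \<in> parcs (copy_graph e G)" for x y
  proof -
    obtain u v where uv: "x = e u" "y = e v" "(u, v) \<in> parcs G"
      using \<open>(x, y) \<in> parcs (copy_graph e G)\<close> by (auto simp: copy_graph_def)
    with assms pair_pseudo_graph_arc_verts[OF assms(2) uv(3)] show ?thesis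
      by (simp add: copy_graph_arc_iff nat_graph_map_def)
  qed
  ultimately show ?thesis
    using assms by (simp add: Hom_graph_category copy_map_def copy_graph_pseudo graph_maps_def)
qed

lemma app_copy_map: "inj e \<Longrightarrow> u \<in> pverts G \<Longrightarrow> app (copy_map e G H f) (e u) = e (f u)"
  by (simp add: copy_map_def)

definition path_graph :: "nat \<Rightarrow> nat pair_pre_digraph" where
  "path_graph n = \<lparr>pverts = {..n}, parcs = {(u, v). u \<le> n \<and> v \<le> n \<and> (v = Suc u \<or> u = Suc v)}\<rparr>"

definition cycle_graph :: "nat \<Rightarrow> nat pair_pre_digraph" where
  "cycle_graph n = \<lparr>pverts = {..<n},
     parcs = {(u, v). u < n \<and> v < n \<and> (v = Suc u mod n \<or> u = Suc v mod n)}\<rparr>"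

text \<open>This is \<open>K + K\<close>, numbered so that the fold map to \<open>K\<close> is
  reduction modulo 2.\<close>

definition two_edges :: "nat pair_pre_digraph" where
  "two_edges = \<lparr>pverts = {0, 1, 2, 3}, parcs = {(0, 1), (1, 0), (2, 3), (3, 2)}\<rparr>"

lemma pverts_path_graph: "pverts (path_graph n) = {..n}"
  by (simp add: path_graph_def)

lemma pseudo_graphs:
  "pair_pseudo_graph (path_graph n)" "pair_pseudo_graph (cycle_graph n)"
  "pair_pseudo_graph two_edges"
  by (auto simp: pair_pseudo_graph_iff path_graph_def cycle_graph_def two_edges_def sym_def)

section \<open>Contracting a path to an edge\<close>

lemma times_homotopicI:
  assumes "pair_pseudo_graph A"
    and "\<And>a k. a \<in> pverts A \<Longrightarrow> k \<le> n \<Longrightarrow> F a k \<in> pverts B"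
    and "\<And>a b k j. (a, b) \<in> parcs A \<Longrightarrow> k \<le> n \<Longrightarrow> j \<le> n \<Longrightarrow> \<bar>int k - int j\<bar> \<le> 1 \<Longrightarrow> (F a k, F b j) \<in> parcs B"
    and "\<And>a. a \<in> pverts A \<Longrightarrow> F a 0 = f a" "\<And>a. a \<in> pverts A \<Longrightarrow> F a n = g a"
  shows "times_homotopic A B f g"
  unfolding times_homotopic_def
proof (intro exI bexI)
  let ?F = "\<lambda>x\<in>pverts A \<times> {0..n}. F (fst x) (snd x)"
  show "\<forall>a\<in>pverts A. ?F (a, 0) = f a \<and> ?F (a, n) = g a" using assms by auto
  show "?F \<in> graph_maps (graph_product A (interval_graph n)) B"
    using assms pair_pseudo_graph_arc_verts[OF assms(1)]
    by (auto simp: graph_maps_def graph_product_def interval_graph_def)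
qed

text \<open>As \<open>c\<close> grows from 1, this is a homotopy unfolding the first edge of a path to the whole path.\<close>

definition fold_to :: "nat \<Rightarrow> nat \<Rightarrow> nat" where
  "fold_to c u = (if u \<le> c then u else if even (u + c) then c else c - 1)"

text \<open>For positive parameters \<open>fold_to\<close> preserves parity, so the two values have
  opposite parity. As they differ by at most 2, they differ by exactly 1.\<close>

lemma fold_to_adjacent:
  assumes "v = Suc u \<or> u = Suc v" "\<bar>int c - int d\<bar> \<le> 1" "1 \<le> c" "1 \<le> d"
  shows "fold_to d v = Suc (fold_to c u) \<or> fold_to c u = Suc (fold_to d v)"
proof -
  have par: "even (fold_to b w) \<longleftrightarrow> even w" if "1 \<le> b" for b w
    using that unfolding fold_to_def by auto
  have "even (fold_to d v) \<noteq> even (fold_to c u)"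
    using assms by (auto simp: par)
  moreover have "fold_to d v \<le> fold_to c u + 2"
    using assms unfolding fold_to_def by (auto split: if_splits)
  moreover have "fold_to c u \<le> fold_to d v + 2"
    using assms unfolding fold_to_def by (auto split: if_splits)
  ultimately show ?thesis by presburger
qed

text \<open>The homotopy inverse includes \<open>K\<close> as the first edge of the path. One
  composite is the identity of \<open>K\<close>; the other is joined to the identity by
  \<open>fold_to\<close>.\<close>

lemma path_parity_weq:
  assumes e: "inj (e :: nat \<Rightarrow> 'v)"
  shows "copy_map e (path_graph (Suc n)) (path_graph (Suc 0)) (\<lambda>u. u mod 2) \<in> times_homotopy_equivalences"
    (is "?q \<in> _")
proof -
  let ?D = "copy_graph e (path_graph (Suc n))" and ?K = "copy_graph e (path_graph (Suc 0))"
  let ?l = "copy_map e (path_graph (Suc 0)) (path_graph (Suc n)) (\<lambda>u. u)"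
  have "nat_graph_map (path_graph (Suc n)) (path_graph (Suc 0)) (\<lambda>u. u mod 2)"
    by (auto simp: nat_graph_map_def path_graph_def) presburger+
  then have q: "?q \<in> Hom graph_category ?D ?K" by (intro copy_map_Hom e pseudo_graphs)
  have "nat_graph_map (path_graph (Suc 0)) (path_graph (Suc n)) (\<lambda>u. u)"
    by (auto simp: nat_graph_map_def path_graph_def)
  then have l: "?l \<in> Hom graph_category ?K ?D" by (intro copy_map_Hom e pseudo_graphs)
  have D: "pair_pseudo_graph ?D" and K: "pair_pseudo_graph ?K" by (auto intro: copy_graph_pseudo pseudo_graphs)
  have homD: "times_homotopic ?D ?D (app (Cmp graph_category ?l ?q)) (app (Idn graph_category ?D))"
  \<comment> \<open>The parameter \<open>Suc k\<close> starts at 1, where \<open>fold_to\<close> is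
    reduction modulo 2, and ends at \<open>Suc n\<close>, where it fixes the whole path.\<close>
  proof (rule times_homotopicI[where F = "\<lambda>x k. e (fold_to (Suc k) (inv e x))" and n = n])
    fix a b :: 'v and k j assume *: "(a, b) \<in> parcs ?D" "\<bar>int k - int j\<bar> \<le> 1" "k \<le> n" "j \<le> n"
    then obtain u v where uv: "a = e u" "b = e v" "u \<le> Suc n" "v \<le> Suc n" "v = Suc u \<or> u = Suc v"
      by (auto simp: copy_graph_def path_graph_def)
    have "fold_to (Suc j) v = Suc (fold_to (Suc k) u) \<or> fold_to (Suc k) u = Suc (fold_to (Suc j) v)"
      using * uv by (intro fold_to_adjacent) auto
    moreover have "fold_to (Suc j) v \<le> Suc n" "fold_to (Suc k) u \<le> Suc n"
      using uv * by (auto simp: fold_to_def)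
    ultimately show "(e (fold_to (Suc k) (inv e a)), e (fold_to (Suc j) (inv e b))) \<in> parcs ?D"
      using uv e by (simp add: copy_graph_arc_iff) (simp add: path_graph_def)
  next
    fix a assume "a \<in> pverts ?D"
    then obtain u where u: "a = e u" "u \<le> Suc n" by (auto simp: copy_graph_def path_graph_def)
    show "e (fold_to (Suc n) (inv e a)) = app (Idn graph_category ?D) a"
      using u e by (simp add: fold_to_def graph_category_def copy_graph_def path_graph_def)
    have "fold_to (Suc 0) u = u mod 2" unfolding fold_to_def by presburger
    moreover have "app (Cmp graph_category ?l ?q) a = e (u mod 2)"
      using u e \<open>a \<in> pverts ?D\<close> by (simp add: app_Cmp[OF q] app_copy_map pverts_path_graph)
    ultimately show "e (fold_to (Suc 0) (inv e a)) = app (Cmp graph_category ?l ?q) a"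
      using u e by simp
  next
    fix a k assume "a \<in> pverts ?D" "k \<le> n"
    then show "e (fold_to (Suc k) (inv e a)) \<in> pverts ?D"
      using e by (auto simp: copy_graph_def path_graph_def fold_to_def)
  qed (fact D)
  have homK: "times_homotopic ?K ?K (app (Cmp graph_category ?q ?l)) (app (Idn graph_category ?K))"
  proof (rule times_homotopicI[where F = "\<lambda>x k. x" and n = 0])
    fix a assume a: "a \<in> pverts ?K"
    then obtain u where u: "a = e u" "u \<le> 1" by (auto simp: copy_graph_def path_graph_def)
    have "u mod 2 = u" using u by auto
    then show "a = app (Cmp graph_category ?q ?l) a"
      using a u e by (simp add: app_Cmp[OF l] app_copy_map pverts_path_graph)
  qed (auto simp: K graph_category_def)
  have "src ?q = ?D" "tgt ?q = ?K" by (simp_all add: copy_map_def)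
  moreover have "?q \<in> Mor graph_category" using q by (simp add: Hom_def)
  ultimately show ?thesis
    using homD homK l unfolding times_homotopy_equivalences_def by auto
qed

section \<open>Two-colourings\<close>

text \<open>Consecutive positions of \<open>u\<close> during the homotopy are both adjacent to one
  position of its neighbour \<open>v\<close>, so they share a colour. An isolated vertex could move
  freely.\<close>

lemma graph_maps_homotopic_two_coloring:
  assumes A: "pair_pseudo_graph A" and uv: "(u, v) \<in> parcs A"
    and hom: "times_homotopic A B f g"
    and k: "\<And>x y. (x, y) \<in> parcs B \<Longrightarrow> k x \<noteq> (k y :: bool)"
  shows "k (f u) = k (g u)"
proof -
  obtain n F where F: "F \<in> graph_maps (graph_product A (interval_graph n)) B"
    and ends: "\<And>a. a \<in> pverts A \<Longrightarrow> F (a, 0) = f a \<and> F (a, n) = g a"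
    using hom unfolding times_homotopic_def by blast
  have adj: "(F (u, i), F (v, j)) \<in> parcs B" if "i \<le> n" "j \<le> n" "\<bar>int i - int j\<bar> \<le> 1" for i j
    using F uv that by (auto simp: graph_maps_def graph_product_def interval_graph_def)
  have "k (F (u, i)) = k (F (u, 0))" if "i \<le> n" for i
    using that
  proof (induction i)
    case (Suc i)
    have "k (F (u, Suc i)) \<noteq> k (F (v, i))" "k (F (u, i)) \<noteq> k (F (v, i))"
      using adj[of "Suc i" i] adj[of i i] k Suc.prems by auto
    with Suc show ?case by auto
  qed simp
  from this[of n] ends[of u] pair_pseudo_graph_arc_verts[OF A uv] show ?thesis by auto
qed

text \<open>Cutting an odd cycle open at a vertex \<open>m\<close> leaves a path, which is 2-colourable.\<close>

lemma cycle_minus_vertex_coloring: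
  assumes "(u, v) \<in> parcs (cycle_graph n)" "m < n" "u \<noteq> m" "v \<noteq> m"
  shows "even (if m < u then u else u + n) \<noteq> even (if m < v then v else v + n)"
proof -
  have uv: "u < n" "v < n" "v = Suc u mod n \<or> u = Suc v mod n"
    using assms(1) by (auto simp: cycle_graph_def)
  \<comment> \<open>Adding \<open>n\<close> to the vertices before \<open>m\<close> makes the arc
    from \<open>n - 1\<close> to \<open>0\<close> join the consecutive numbers \<open>n - 1\<close>
    and \<open>n\<close>.\<close>
  have "Suc x mod n = (if Suc x = n then 0 else Suc x)" if "x < n" for x
    using that by auto
  with uv show ?thesis using assms by (auto split: if_splits)
qed

section \<open>The odd cycle argument\<close>

theorem theorem3p6:
  shows "\<not> (\<exists>cof :: 'v::infinite gmorph set.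
    cofibration_category (graph_category :: ('v pair_pre_digraph, 'v gmorph) cat_data)
      times_homotopy_equivalences cof)"
proof
  let ?G = "graph_category :: ('v pair_pre_digraph, 'v gmorph) cat_data"
  assume "\<exists>cof. cofibration_category ?G times_homotopy_equivalences cof"
  then obtain cof where "cofibration_category ?G times_homotopy_equivalences cof" by blast
  then interpret cofibration_category ?G times_homotopy_equivalences cof .
  obtain e :: "nat \<Rightarrow> 'v" where e: "inj e"
    using infinite_countable_subset[OF infinite_UNIV] by blast
  let ?c = "copy_graph e"
  let ?A = "?c two_edges" and ?K = "?c (path_graph (Suc 0))"
  let ?fold = "copy_map e two_edges (path_graph (Suc 0)) (\<lambda>u. u mod 2)"
  have "nat_graph_map two_edges (path_graph (Suc 0)) (\<lambda>u. u mod 2)"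
    by (auto simp: nat_graph_map_def two_edges_def path_graph_def)
  then have fold: "?fold \<in> Hom ?G ?A ?K" by (intro copy_map_Hom e pseudo_graphs)
  then obtain i p where ip: "i \<in> cof" "p \<in> times_homotopy_equivalences" "Cod ?G i = Dom ?G p"
      "Cmp ?G p i = ?fold"
    using factorization[of ?fold] by (auto simp: Hom_def)
  define X where "X = tgt i"
  have "i \<in> Mor ?G" "p \<in> Mor ?G" using ip cof_subset weq_subset by auto
  moreover have "src i = ?A" "tgt p = ?K" using ip(4) by (auto simp: Cmp_graph_category copy_map_def)
  ultimately have i: "i \<in> Hom ?G ?A X" and p: "p \<in> Hom ?G X ?K"
    using ip(3) by (auto simp: Hom_def graph_category_def X_def)
  have X: "pair_pseudo_graph X" using p by (simp add: Hom_graph_category)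
  then have finX: "finite (pverts X)" by (simp add: pair_pseudo_graph_iff)
  \<comment> \<open>\<open>N\<close> is odd, greater than 1, and exceeds the number of vertices of
    \<open>X\<close>.\<close>
  define N where "N = 2 * card (pverts X) + 3"
  let ?D = "?c (path_graph (Suc N))" and ?M = "?c (cycle_graph N)"
  let ?q = "copy_map e (path_graph (Suc N)) (path_graph (Suc 0)) (\<lambda>u. u mod 2)"
  \<comment> \<open>The second edge goes to the far end in reversed order: 2 to \<open>N + 1\<close>
    and 3 to \<open>N\<close>. As \<open>N\<close> is odd, parity is kept; modulo \<open>N\<close>,
    however, 2 meets 1 and 3 meets 0, which is the twist.\<close>
  define lam :: "nat \<Rightarrow> nat" where "lam = (\<lambda>u. if u \<le> 1 then u else N + 3 - u)"
  let ?l = "copy_map e two_edges (path_graph (Suc N)) lam"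
  let ?d = "copy_map e (path_graph (Suc N)) (cycle_graph N) (\<lambda>u. u mod N)"
  have "nat_graph_map (path_graph (Suc N)) (path_graph (Suc 0)) (\<lambda>u. u mod 2)"
    by (auto simp: nat_graph_map_def path_graph_def) presburger+
  then have q: "?q \<in> Hom ?G ?D ?K" by (intro copy_map_Hom e pseudo_graphs)
  have "nat_graph_map two_edges (path_graph (Suc N)) lam"
    by (auto simp: nat_graph_map_def path_graph_def two_edges_def lam_def N_def)
  then have l: "?l \<in> Hom ?G ?A ?D" by (intro copy_map_Hom e pseudo_graphs)
  have "nat_graph_map (path_graph (Suc N)) (cycle_graph N) (\<lambda>u. u mod N)"
    by (auto simp: nat_graph_map_def path_graph_def cycle_graph_def N_def mod_Suc_eq)
  then have d: "?d \<in> Hom ?G ?D ?M" by (intro copy_map_Hom e pseudo_graphs)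
  have lam_mod: "lam u mod 2 = u mod 2" if "u \<in> pverts two_edges" for u
    using that by (auto simp: two_edges_def lam_def N_def)
  have lam_in: "lam u \<in> pverts (path_graph (Suc N))" if "u \<in> pverts two_edges" for u
    using that by (auto simp: two_edges_def lam_def path_graph_def)
  have eq: "Cmp ?G p i = Cmp ?G ?q ?l" unfolding ip(4)
  proof (rule gmorph_eqI[OF fold Cmp_Hom_graph_category[OF l q]])
    fix a assume a: "a \<in> pverts ?A"
    then obtain u where u: "a = e u" "u \<in> pverts two_edges" by (auto simp: copy_graph_def)
    then show "app ?fold a = app (Cmp ?G ?q ?l) a"
      using a e by (simp add: app_Cmp[OF l] app_copy_map lam_mod lam_in)
  qed
  have "\<exists>W. \<exists>a\<in>Hom ?G X W. \<exists>w\<in>Hom ?G ?M W.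
      w \<in> times_homotopy_equivalences \<and> Cmp ?G a i = Cmp ?G w (Cmp ?G ?d ?l)"
    by (rule cofibration_into_weak_pushout[OF _ i ip(1) p l q path_parity_weq[OF e] eq d])
      (rule graph_category_pushout)
  then obtain W a w where a: "a \<in> Hom ?G X W" and w: "w \<in> Hom ?G ?M W"
      "w \<in> times_homotopy_equivalences" and aw: "Cmp ?G a i = Cmp ?G w (Cmp ?G ?d ?l)" by blast
  \<comment> \<open>A homotopy inverse of \<open>w\<close> provides a graph map from
    \<open>W\<close> back to the cycle.\<close>
  obtain b where b: "b \<in> Hom ?G W ?M"
    using w by (auto simp: times_homotopy_equivalences_def Hom_graph_category)
  define phi where "phi = (\<lambda>x. inv e (app b (app a x)))"
  have baX: "app b (app a x) \<in> pverts ?M" if "x \<in> pverts X" for x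
    using a b that by (auto simp: Hom_graph_category graph_maps_def)
  have phi: "phi x < N" if "x \<in> pverts X" for x
    using baX[OF that] e by (auto simp: phi_def copy_graph_def cycle_graph_def)
  have phi_arc: "(phi x, phi y) \<in> parcs (cycle_graph N)" if "(x, y) \<in> parcs X" for x y
  proof -
    have "(app b (app a x), app b (app a y)) \<in> parcs ?M"
      using a b that by (auto simp: Hom_graph_category graph_maps_def)
    then show ?thesis using e by (auto simp: phi_def copy_graph_def)
  qed
  have phi_i: "phi (app i (e u)) = inv e (app b (app w (e (lam u mod N))))"
    if u: "u \<in> pverts two_edges" for u
  proof -
    have eu: "e u \<in> pverts ?A" using u by (auto simp: copy_graph_def)
    have "app a (app i (e u)) = app (Cmp ?G w (Cmp ?G ?d ?l)) (e u)"
      using app_Cmp[OF i eu, of a] aw by simp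
    also have "\<dots> = app w (e (lam u mod N))"
      using u eu lam_in[OF u] e
      by (simp add: app_Cmp[OF Cmp_Hom_graph_category[OF l d]] app_Cmp[OF l] app_copy_map pverts_path_graph)
    finally show ?thesis by (simp add: phi_def)
  qed
  have "phi ` pverts X \<noteq> {..<N}"
  proof
    assume "phi ` pverts X = {..<N}"
    then have "N \<le> card (pverts X)" using card_image_le[OF finX, of phi] by simp
    then show False by (simp add: N_def)
  qed
  then obtain m where m: "m < N" "m \<notin> phi ` pverts X" using phi by auto
  \<comment> \<open>The vertices of the cycle other than \<open>m\<close> are numbered consecutively
    from \<open>m + 1\<close> to \<open>m + N - 1\<close>; the parity of this number is pulled back
    along \<open>phi\<close>.\<close>
  define k where "k = (\<lambda>x. even (if m < phi x then phi x else phi x + N))"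
  have k: "k x \<noteq> k y" if "(x, y) \<in> parcs X" for x y
    unfolding k_def using that m pair_pseudo_graph_arc_verts[OF X that]
    by (intro cycle_minus_vertex_coloring[OF phi_arc]) auto
  obtain s where s: "s \<in> Hom ?G ?K X"
    and hom: "times_homotopic X X (app (Cmp ?G s p)) (app (Idn ?G X))"
    using ip(2) p by (auto simp: times_homotopy_equivalences_def Hom_graph_category)
  have i_arc: "(app i (e u), app i (e v)) \<in> parcs X" if "(u, v) \<in> parcs two_edges" for u v
    using i that copy_graph_arc_iff[OF e, of u v two_edges]
    by (auto simp: Hom_graph_category graph_maps_def)
  have k_sp: "k (app s (app p x)) = k x" if xy: "(x, y) \<in> parcs X" for x y
  proof -
    have "k (app (Cmp ?G s p) x) = k (app (Idn ?G X) x)"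
      using graph_maps_homotopic_two_coloring[OF X xy hom] k by blast
    then show ?thesis
      using pair_pseudo_graph_arc_verts[OF X xy] by (simp add: app_Cmp[OF p]) (simp add: graph_category_def)
  qed
  have p_i: "app p (app i (e u)) = e (u mod 2)" if u: "u \<in> pverts two_edges" for u
  proof -
    have "e u \<in> pverts ?A" using u by (auto simp: copy_graph_def)
    from app_Cmp[OF i this, of p] show ?thesis using ip(4) u e by (simp add: app_copy_map)
  qed
  \<comment> \<open>The fold map \<open>p i\<close> sends 0 and 2 to the same vertex of
    \<open>K\<close>, and \<open>s p\<close> preserves the colours of both ends.\<close>
  have "k (app i (e 0)) = k (app i (e 2))"
    using k_sp[OF i_arc[of 0 1]] k_sp[OF i_arc[of 2 3]] p_i[of 0] p_i[of 2] by (simp add: two_edges_def)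
  \<comment> \<open>By the twist, 2 takes the colour of 1, which is adjacent to 0.\<close>
  moreover have "lam 2 = 1 + N" "lam 1 = 1" by (simp_all add: lam_def)
  then have "lam 2 mod N = lam 1 mod N" by (simp only: mod_add_self2)
  then have "phi (app i (e 2)) = phi (app i (e 1))"
    using phi_i[of 1] phi_i[of 2] by (simp add: two_edges_def)
  then have "k (app i (e 2)) = k (app i (e 1))" by (simp add: k_def)
  moreover have "k (app i (e 0)) \<noteq> k (app i (e 1))" using k[OF i_arc[of 0 1]] by (simp add: two_edges_def)
  ultimately show False by simp
qed

end
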